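(* The Macdonald tree is not isomorphic (as a graph) to the graph $\mathbb B$ of sequences of binary strings, i.e. to the branching graph of one-dimensional representations of the Sylow 2-subgroups $P_n$ of the symmetric groups $S_n$.
   Context: Macdonald tree. Its vertices are the integer partitions $\lambda$ of $n$, $n\ge1$, such that the irreducible representation of $S_n$ indexed by $\lambda$ has odd dimension; two such partitions are joined by an edge when one is obtained from the other by adding one box to its Young diagram (so it is the induced subgraph of Young's graph on odd-dimensional partitions). The graph $\mathbb B$. For $n=2^{k_1}+\dots+2^{k_s}\ge1$ with $k_1>\dots>k_s\ge0$, a sequence of strings of size $n$ is a tuple $(b_1,\dots,b_s)$ of binary strings with $b_i$ of length $k_i$ (the string of length $0$ is the empty string $\varepsilon$). For a binary string $b$ of length $k\ge1$, let $\overline b$ be $b$ with its leading bit removed, and let $\mathrm{Res}(b)=(\overline b,\overline{\overline b},\dots,\varepsilon)$, a sequence of size $2^k-1$; let $\mathrm{Res}(\varepsilon)$ be the empty sequence. For a sequence $S=(b_1,\dots,b_s)$ of size $n$, $\mathrm{Res}(S)$ is the concatenation of $(b_1,\dots,b_{s-1})$ with $\mathrm{Res}(b_s)$, a sequence of size $n-1$. The vertices of $\mathbb B$ are all sequences of strings of size $n$, $n\ge1$, with an edge between $S$ and $\mathrm{Res}(S)$ for every $S$ of size $n\ge2$. The graph $\mathbb B$ encodes the graph whose vertices are the one-dimensional representations of $P_n$ ($n\ge 1$) with edges given by restriction from $P_n$ to $P_{n-1}$. *)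

theory Defs
  imports
    Complex_Main
    "HOL-Library.Function_Algebras"
    "HOL-Combinatorics.Permutations"
    "Graph_Theory.Pair_Digraph"
    "Graph_Theory.Digraph_Isomorphism"
begin

section \<open>Partitions, tableaux and Specht modules\<close>

definition partition_of :: "nat \<Rightarrow> nat list \<Rightarrow> bool" where
  "partition_of n \<mu> \<longleftrightarrow> sorted_wrt (\<ge>) \<mu> \<and> 0 \<notin> set \<mu> \<and> sum_list \<mu> = n"

text \<open>Boxes are pairs (row, column), both counted from 0.\<close>

definition young_diagram :: "nat list \<Rightarrow> (nat \<times> nat) set" where
  "young_diagram \<mu> = {(i, j). i < length \<mu> \<and> j < \<mu> ! i}"

definition diagram_row :: "nat list \<Rightarrow> nat \<Rightarrow> (nat \<times> nat) set" where
  "diagram_row \<mu> i = {c \<in> young_diagram \<mu>. fst c = i}"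

definition diagram_col :: "nat list \<Rightarrow> nat \<Rightarrow> (nat \<times> nat) set" where
  "diagram_col \<mu> j = {c \<in> young_diagram \<mu>. snd c = j}"

text \<open>Tableaux are bijective fillings, with no monotonicity condition. They are made
  extensional so that a tableau is determined by its entries on the diagram.\<close>

definition tableaux :: "nat list \<Rightarrow> (nat \<times> nat \<Rightarrow> nat) set" where
  "tableaux \<mu> =
     {t \<in> extensional (young_diagram \<mu>). bij_betw t (young_diagram \<mu>) {1..sum_list \<mu>}}"

text \<open>The row-equivalence class of \<open>t\<close>. Only the values of \<open>t\<close> on the diagram matter, so
  \<open>tabloid \<mu> (\<pi> \<circ> t)\<close> is the tabloid of the tableau obtained by letting \<open>\<pi>\<close> act on
  the entries of \<open>t\<close>, although \<open>\<pi> \<circ> t\<close> need not be extensional.\<close>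

definition tabloid :: "nat list \<Rightarrow> (nat \<times> nat \<Rightarrow> nat) \<Rightarrow> (nat \<times> nat \<Rightarrow> nat) set" where
  "tabloid \<mu> t =
     {s \<in> tableaux \<mu>. \<forall>i. s ` diagram_row \<mu> i = t ` diagram_row \<mu> i}"

definition col_stabilizer :: "nat list \<Rightarrow> (nat \<times> nat \<Rightarrow> nat) \<Rightarrow> (nat \<Rightarrow> nat) set" where
  "col_stabilizer \<mu> t =
     {\<pi>. \<pi> permutes {1..sum_list \<mu>} \<and>
         (\<forall>j. \<pi> ` (t ` diagram_col \<mu> j) = t ` diagram_col \<mu> j)}"

text \<open>The Specht module (James) of shape \<open>\<mu>\<close> is the complex span, inside the permutation
  module on the tabloids of shape \<open>\<mu>\<close>, of the polytabloids, where the polytabloid of \<open>t\<close>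
  is the sum of \<open>sign \<pi>\<close> times the tabloid of \<open>\<pi> \<circ> t\<close> over all \<open>\<pi>\<close> in the column
  stabilizer of \<open>t\<close>. A formal complex combination of tabloids is represented by its
  coefficient function. The Specht module is the irreducible complex representation of the
  symmetric group indexed by \<open>\<mu>\<close>.\<close>

definition polytabloid ::
    "nat list \<Rightarrow> (nat \<times> nat \<Rightarrow> nat) \<Rightarrow> ((nat \<times> nat \<Rightarrow> nat) set \<Rightarrow> complex)" where
  "polytabloid \<mu> t =
     (\<lambda>T. \<Sum>\<pi>\<in>col_stabilizer \<mu> t. if tabloid \<mu> (\<pi> \<circ> t) = T then of_int (sign \<pi>) else 0)"

definition cscale :: "complex \<Rightarrow> ('a \<Rightarrow> complex) \<Rightarrow> ('a \<Rightarrow> complex)" where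
  "cscale a f = (\<lambda>x. a * f x)"

global_interpretation cfun: vector_space "cscale :: complex \<Rightarrow> ('a \<Rightarrow> complex) \<Rightarrow> _"
  defines cfun_span = cfun.span and cfun_dim = cfun.dim
  by unfold_locales (auto simp: cscale_def fun_eq_iff algebra_simps)

definition specht_module :: "nat list \<Rightarrow> ((nat \<times> nat \<Rightarrow> nat) set \<Rightarrow> complex) set" where
  "specht_module \<mu> = cfun.span (polytabloid \<mu> ` tableaux \<mu>)"

definition irrep_dim :: "nat list \<Rightarrow> nat" where
  "irrep_dim \<mu> = cfun.dim (specht_module \<mu>)"

section \<open>The Macdonald tree\<close>

definition adds_box :: "nat list \<Rightarrow> nat list \<Rightarrow> bool" where
  "adds_box \<mu> \<nu> \<longleftrightarrow> (\<exists>c. c \<notin> young_diagram \<mu> \<and> young_diagram \<nu> = insert c (young_diagram \<mu>))"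

definition odd_partitions :: "nat list set" where
  "odd_partitions = {\<mu>. (\<exists>n\<ge>1. partition_of n \<mu>) \<and> odd (irrep_dim \<mu>)}"

text \<open>As usual in the graph library, an undirected simple graph is a symmetric digraph without
  loops and parallel arcs: each edge is represented by both of its orientations.\<close>

definition macdonald_tree :: "nat list pair_pre_digraph" where
  "macdonald_tree =
     \<lparr> pverts = odd_partitions,
       parcs = {(\<mu>, \<nu>). \<mu> \<in> odd_partitions \<and> \<nu> \<in> odd_partitions \<and>
                        (adds_box \<mu> \<nu> \<or> adds_box \<nu> \<mu>)} \<rparr>"

section \<open>The graph of sequences of binary strings\<close>

text \<open>A binary string is a list of bits with the leading bit first. The binary expansion of
  \<open>n\<close> is read off from the lengths of the strings.\<close>

definition string_sequence :: "nat \<Rightarrow> bool list list \<Rightarrow> bool" where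
  "string_sequence n S \<longleftrightarrow>
     sorted_wrt (>) (map length S) \<and> (\<Sum>b\<leftarrow>S. 2 ^ length b) = n"

primrec Res_string :: "bool list \<Rightarrow> bool list list" where
  "Res_string [] = []"
| "Res_string (x # b) = b # Res_string b"

definition Res :: "bool list list \<Rightarrow> bool list list" where
  "Res S = butlast S @ Res_string (last S)"

definition string_graph :: "bool list list pair_pre_digraph" where
  "string_graph =
     (let E = {(S, Res S) | S. \<exists>n\<ge>2. string_sequence n S} in
      \<lparr> pverts = {S. \<exists>n\<ge>1. string_sequence n S}, parcs = E \<union> E\<inverse> \<rparr>)"

section \<open>Well-formedness\<close>

lemma string_sequence_Res_string: "string_sequence (2 ^ length b - 1) (Res_string b)"
  and length_Res_string: "c \<in> set (Res_string b) \<Longrightarrow> length c < length b"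
proof -
  have len: "c \<in> set (Res_string b) \<Longrightarrow> length c < length b" for b c
    by (induction b) auto
  have "sorted_wrt (>) (map length (Res_string b)) \<and>
      (\<Sum>c\<leftarrow>Res_string b. 2 ^ length c) + 1 = (2 ^ length b :: nat)"
    by (induction b) (auto dest: len)
  then show "string_sequence (2 ^ length b - 1) (Res_string b)"
    unfolding string_sequence_def by (metis add_diff_cancel_right')
  show "c \<in> set (Res_string b) \<Longrightarrow> length c < length b" by (rule len)
qed

lemma string_sequence_Res:
  assumes "string_sequence n S" "n \<ge> 1"
  shows "string_sequence (n - 1) (Res S)"
proof -
  from assms have "S \<noteq> []" by (auto simp: string_sequence_def)
  then obtain S' b where S: "S = S' @ [b]" by (metis append_butlast_last_id)
  have "sorted_wrt (>) (map length S')" "\<forall>c\<in>set S'. length b < length c"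
    "n = (\<Sum>c\<leftarrow>S'. 2 ^ length c) + 2 ^ length b"
    using assms(1) by (auto simp: S string_sequence_def sorted_wrt_append)
  then show ?thesis
    using string_sequence_Res_string[of b] length_Res_string[of _ b]
    by (fastforce simp: S Res_def string_sequence_def sorted_wrt_append)
qed

lemma pair_wf_digraph_macdonald_tree: "pair_wf_digraph macdonald_tree"
  by unfold_locales (auto simp: macdonald_tree_def)

lemma pair_wf_digraph_string_graph: "pair_wf_digraph string_graph"
proof -
  have "\<exists>m\<ge>1. string_sequence m (Res S)" if "string_sequence n S" "n \<ge> 2" for n S
    using string_sequence_Res[OF that(1)] that(2) by (intro exI[of _ "n - 1"]) auto
  moreover have "\<exists>m\<ge>1. string_sequence m S" if "string_sequence n S" "n \<ge> 2" for n S
    using that by (intro exI[of _ n]) auto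
  ultimately show ?thesis
    by unfold_locales (auto simp: string_graph_def Let_def)
qed

end

theory Submission
  imports Defs
begin

text \<open>In \<open>B\<close> a vertex of odd size at least 3 has degree 1 or 3, because the children of \<open>S\<close>
  come in pairs differing in a leading bit. In the Macdonald tree the partitions \<open>(1)\<close>,
  \<open>(2)\<close> and \<open>(1,1)\<close> all have degree 2, which forces an isomorphism to send \<open>(1)\<close> to the
  sequence of size 1, and hence to preserve sizes along paths leading away from \<open>(1)\<close>.
  Now \<open>(5)\<close> has two descendants of size 8, namely \<open>(8)\<close> and \<open>(6,1,1)\<close>, that branch off
  immediately above \<open>(5)\<close>. In \<open>B\<close> the vertices of size 8 are the strings \<open>xyz\<close> of length 3;
  the ancestor \<open>(yz, \<epsilon>)\<close> of size 5 determines the ancestor \<open>(yz, z)\<close> of size 6, so two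
  such descendants cannot exist. All partitions involved are hooks, and the Specht module of
  the hook with arm length \<open>a\<close> and leg length \<open>k\<close> has dimension \<open>(a + k) choose k\<close>: by the
  Garnir relations the polytabloids with entry 1 in the first column span it.\<close>

section \<open>Sequences of binary strings\<close>

abbreviation level :: "bool list list \<Rightarrow> nat" where
  "level S \<equiv> \<Sum>b\<leftarrow>S. 2 ^ length b"

lemma string_graph_vertex_iff:
  "S \<in> pverts string_graph \<longleftrightarrow> sorted_wrt (>) (map length S) \<and> S \<noteq> []"
  by (cases S) (auto simp: string_graph_def Let_def string_sequence_def intro: Suc_leI)

lemma string_graph_arc_iff:
  "(S, T) \<in> parcs string_graph \<longleftrightarrow>
     (S \<in> pverts string_graph \<and> 2 \<le> level S \<and> T = Res S) \<or>
     (T \<in> pverts string_graph \<and> 2 \<le> level T \<and> S = Res T)"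
  by (auto simp: string_graph_def Let_def string_sequence_def)

section \<open>Sizes, degrees and paths in the graph of sequences\<close>

lemma level_Res: "S \<in> pverts string_graph \<Longrightarrow> Suc (level (Res S)) = level S"
  using string_sequence_Res[of "level S" S]
  by (force simp: string_graph_def Let_def string_sequence_def)

lemma level_arc:
  assumes "(S, T) \<in> parcs string_graph"
  shows "level T = Suc (level S) \<and> S = Res T \<or> level S = Suc (level T) \<and> T = Res S"
  using assms level_Res[of S] level_Res[of T] by (auto simp: string_graph_arc_iff)

text \<open>The lengths decrease strictly, so the tail contributes distinct powers of 2 below the
  leading one, whose sum stays smaller.\<close>

lemma level_bounds:
  assumes "sorted_wrt (>) (map length (b # S))"
  shows "level S < 2 ^ length b"
  using assms
proof (induction S arbitrary: b)
  case (Cons c S)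
  have "level (c # S) < 2 * 2 ^ length c"
    using Cons.IH[of c] Cons.prems by simp
  also have "\<dots> \<le> 2 ^ length b"
    using Cons.prems power_increasing[of "Suc (length c)" "length b" "2 :: nat"] by simp
  finally show ?case .
qed simp

text \<open>Uniqueness of binary expansions: \<open>level_bounds\<close> forces the first string to
  have length \<open>k\<close>, and this string already accounts for the whole size.\<close>

lemma level_power:
  assumes "S \<in> pverts string_graph" "level S = 2 ^ k"
  obtains b where "S = [b]" "length b = k"
proof -
  from assms(1) obtain b S' where S: "S = b # S'" and s: "sorted_wrt (>) (map length (b # S'))"
    by (cases S) (auto simp: string_graph_vertex_iff)
  have "2 ^ length b \<le> (2 :: nat) ^ k" using assms(2) by (simp add: S flip: assms(2))
  then have "length b \<le> k" by simp
  have "(2 :: nat) ^ k < 2 ^ Suc (length b)"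
    using level_bounds[OF s] by (simp add: S flip: assms(2))
  then have "k < Suc (length b)" by (rule power_less_imp_less_exp[rotated]) simp
  with \<open>length b \<le> k\<close> have "length b = k" by simp
  with assms(2) have "level S' = 0" by (simp add: S)
  then have "S' = []" by (cases S') auto
  with S \<open>length b = k\<close> that show ?thesis by simp
qed

text \<open>Only an empty string contributes an odd power of 2, and strictly decreasing lengths
  allow it in the last position only.\<close>

lemma even_level_last:
  assumes "S \<in> pverts string_graph" "even (level S)"
  obtains S' x b where "S = S' @ [x # b]"
proof -
  from assms(1) obtain S' c where S: "S = S' @ [c]" and s: "sorted_wrt (>) (map length (S' @ [c]))"
    by (metis append_butlast_last_id string_graph_vertex_iff)
  have "even (level S')"
    using s by (induction S') auto
  with assms(2) S have "c \<noteq> []" by auto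
  then show ?thesis using that S by (cases c) auto
qed

text \<open>One neighbour is the parent \<open>Res S\<close>. Any other neighbour is a child, whose
  size is even, so its last string is nonempty. Flipping the leading bit of that string gives a
  further child, hence a third neighbour.\<close>

lemma odd_level_degree:
  assumes "S \<in> pverts string_graph" "odd (level S)" "3 \<le> level S"
  shows "card {T. (S, T) \<in> parcs string_graph} \<noteq> 2"
proof
  let ?N = "{T. (S, T) \<in> parcs string_graph}"
  assume card: "card ?N = 2"
  have R: "Res S \<in> ?N" using assms by (simp add: string_graph_arc_iff)
  then have "card (?N - {Res S}) = 1" using card by (simp add: card_Diff_singleton)
  then obtain T where "?N - {Res S} = {T}" by (auto simp: card_1_singleton_iff)
  with R have T: "T \<in> ?N" "T \<noteq> Res S" "?N = {Res S, T}" by blast+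
  then have v: "T \<in> pverts string_graph" "S = Res T" by (auto simp: string_graph_arc_iff)
  then have l: "level T = Suc (level S)" using level_Res[of T] by simp
  with even_level_last[OF v(1)] assms(2) obtain T' x b where T': "T = T' @ [x # b]" by auto
  let ?U = "T' @ [(\<not> x) # b]"
  have "?U \<in> pverts string_graph" "Res ?U = S" "level ?U = level T"
    using v by (auto simp: string_graph_vertex_iff T' Res_def)
  then have "?U \<in> ?N" using l assms(3) by (simp add: string_graph_arc_iff)
  moreover have "?U \<noteq> T" by (simp add: T')
  moreover have "?U \<noteq> Res S"
  proof
    assume "?U = Res S"
    with \<open>level ?U = level T\<close> have "level (Res S) = level T" by (simp only:)
    with level_Res[OF assms(1)] l show False by linarith
  qed
  ultimately show False using T(3) by blast
qed

text \<open>The last string is nonempty, so the empty string may be appended, and \<open>Res\<close>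
  removes it again. This supplies a neighbour of odd size.\<close>

lemma even_level_arc:
  assumes "S \<in> pverts string_graph" "even (level S)"
  shows "(S, S @ [[]]) \<in> parcs string_graph" "level (S @ [[]]) = Suc (level S)"
proof -
  from assms obtain S' x b where S: "S = S' @ [x # b]" by (rule even_level_last)
  have "S @ [[]] \<in> pverts string_graph"
    using assms(1) by (auto simp: string_graph_vertex_iff S sorted_wrt_append)
  moreover have "level S > 0" by (simp add: S)
  ultimately show "(S, S @ [[]]) \<in> parcs string_graph"
    by (simp add: string_graph_arc_iff Res_def)
qed simp

text \<open>Odd sizes from 3 on are excluded by the degree of \<open>S\<close> itself. An even size
  is excluded by the neighbour \<open>S @ [[]]\<close>, whose size is odd and at least 3.\<close>

lemma level_one_if_degree_two:
  assumes "S \<in> pverts string_graph" "card {T. (S, T) \<in> parcs string_graph} = 2"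
    and "\<And>T. (S, T) \<in> parcs string_graph \<Longrightarrow> card {U. (T, U) \<in> parcs string_graph} = 2"
  shows "level S = 1"
proof (cases "even (level S)")
  case True
  from assms(1) obtain c S' where "S = c # S'" by (cases S) (auto simp: string_graph_vertex_iff)
  then have "level S > 0" by simp
  with True have "level S \<ge> 2" by (cases "level S = 1") auto
  have arc: "(S, S @ [[]]) \<in> parcs string_graph" "level (S @ [[]]) = Suc (level S)"
    using even_level_arc[OF assms(1) True] by auto
  have "S @ [[]] \<in> pverts string_graph"
    using arc(1) pair_wf_digraph.in_arcsD2[OF pair_wf_digraph_string_graph] by blast
  with odd_level_degree[of "S @ [[]]"] True \<open>level S \<ge> 2\<close> arc assms(3) show ?thesis by auto
next
  case False
  with odd_level_degree[OF assms(1)] assms(2) show ?thesis by (cases "level S = 1") (auto elim!: oddE)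
qed

text \<open>The only neighbour of \<open>T\<close> below it is \<open>Res T\<close>, which is
  \<open>S\<close> here. A path that has gone up and does not turn back therefore goes up
  again.\<close>

lemma level_step:
  assumes "(S, T) \<in> parcs string_graph" "(T, U) \<in> parcs string_graph" "S \<noteq> U"
    and "level T = Suc (level S)"
  shows "level U = Suc (level T)" "T = Res U"
  using level_arc[OF assms(1)] level_arc[OF assms(2)] assms(3,4) by auto

text \<open>From the string xyz, two applications of \<open>Res\<close> leave (yz, z) and three
  leave (yz, \<epsilon>). Both contain exactly the information y, z.\<close>

lemma Res_Res_eq_if_level_eight:
  assumes "S \<in> pverts string_graph" "level S = 8" "T \<in> pverts string_graph" "level T = 8"
    and "Res (Res (Res S)) = Res (Res (Res T))"
  shows "Res (Res S) = Res (Res T)"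
proof -
  obtain b where "S = [b]" "length b = 3"
    using level_power[of S 3] assms(1,2) by auto
  moreover obtain c where "T = [c]" "length c = 3"
    using level_power[of T 3] assms(3,4) by auto
  ultimately show ?thesis using assms(5) by (auto simp: Res_def length_Suc_conv numeral_3_eq_3)
qed

section \<open>Fillings and polytabloids of hook shape\<close>

text \<open>Extensionality is dropped from \<open>tableaux\<close>, so that fillings are closed
  under composition with permutations of the entries.\<close>

abbreviation filling :: "nat list \<Rightarrow> (nat \<times> nat \<Rightarrow> nat) \<Rightarrow> bool" where
  "filling \<mu> t \<equiv> bij_betw t (young_diagram \<mu>) {1..sum_list \<mu>}"

lemma restrict_in_tableaux: "filling \<mu> t \<Longrightarrow> restrict t (young_diagram \<mu>) \<in> tableaux \<mu>"
  by (auto simp: tableaux_def cong: bij_betw_cong)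

lemma diagram_row_subset: "diagram_row \<mu> i \<subseteq> young_diagram \<mu>"
  and diagram_col_subset: "diagram_col \<mu> j \<subseteq> young_diagram \<mu>"
  by (auto simp: diagram_row_def diagram_col_def)

lemma filling_compose: "\<sigma> permutes {1..sum_list \<mu>} \<Longrightarrow> filling \<mu> t \<Longrightarrow> filling \<mu> (\<sigma> \<circ> t)"
  by (blast intro: bij_betw_trans permutes_imp_bij)

text \<open>Since \<open>s\<close> is a filling, its restriction to the diagram belongs to its
  tabloid, so the row contents can be read off from the set.\<close>

lemma tabloid_eq_iff:
  assumes "filling \<mu> s"
  shows "tabloid \<mu> s = tabloid \<mu> t \<longleftrightarrow> (\<forall>i. s ` diagram_row \<mu> i = t ` diagram_row \<mu> i)"
proof
  let ?s = "restrict s (young_diagram \<mu>)"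
  have rows: "?s ` diagram_row \<mu> i = s ` diagram_row \<mu> i" for i
    using diagram_row_subset[of \<mu> i] by (intro image_cong) auto
  assume "tabloid \<mu> s = tabloid \<mu> t"
  moreover have "?s \<in> tabloid \<mu> s"
    using restrict_in_tableaux[OF assms] rows by (simp add: tabloid_def)
  ultimately show "\<forall>i. s ` diagram_row \<mu> i = t ` diagram_row \<mu> i"
    using rows by (auto simp: tabloid_def)
qed (auto simp: tabloid_def)

text \<open>Allows passing from a filling to the extensional tableau that it restricts to.\<close>

lemma polytabloid_cong:
  assumes "\<And>c. c \<in> young_diagram \<mu> \<Longrightarrow> s c = t c"
  shows "polytabloid \<mu> s = polytabloid \<mu> t"
proof -
  have "s ` diagram_col \<mu> j = t ` diagram_col \<mu> j" for j
    using diagram_col_subset[of \<mu> j] assms by (intro image_cong) auto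
  then have "col_stabilizer \<mu> s = col_stabilizer \<mu> t"
    by (simp add: col_stabilizer_def)
  moreover have "(\<pi> \<circ> s) ` diagram_row \<mu> i = (\<pi> \<circ> t) ` diagram_row \<mu> i" for \<pi> :: "nat \<Rightarrow> nat" and i
    using diagram_row_subset[of \<mu> i] assms by (intro image_cong) auto
  then have "tabloid \<mu> (\<pi> \<circ> s) = tabloid \<mu> (\<pi> \<circ> t)" for \<pi> :: "nat \<Rightarrow> nat"
    by (simp add: tabloid_def)
  ultimately show ?thesis by (simp add: polytabloid_def)
qed

section \<open>Hook shapes: diagrams, tabloids and column stabilizers\<close>

definition hook :: "nat \<Rightarrow> nat \<Rightarrow> nat list" where
  "hook a k = Suc a # replicate k 1"

text \<open>This is the whole first column: it includes the corner and has \<open>k + 1\<close>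
  boxes.\<close>

abbreviation leg :: "nat \<Rightarrow> (nat \<times> nat) set" where
  "leg k \<equiv> (\<lambda>i. (i, 0)) ` {..k}"

lemma young_diagram_hook: "young_diagram (hook a k) = Pair 0 ` {..a} \<union> leg k"
  by (auto simp: hook_def young_diagram_def nth_Cons image_iff split: nat.splits)

lemma sum_list_hook: "sum_list (hook a k) = Suc (a + k)"
  by (simp add: hook_def sum_list_replicate)

lemma diagram_row_hook:
  "diagram_row (hook a k) i = (if i = 0 then Pair 0 ` {..a} else if i \<le> k then {(i, 0)} else {})"
  by (auto simp: diagram_row_def young_diagram_hook)

lemma diagram_col_hook:
  "diagram_col (hook a k) j = (if j = 0 then leg k else if j \<le> a then {(0, j)} else {})"
  by (auto simp: diagram_col_def young_diagram_hook)

lemma leg_subset: "leg k \<subseteq> young_diagram (hook a k)"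
  by (simp add: young_diagram_hook)

text \<open>Every row below the first is a single box, and the first row contains exactly the
  remaining entries.\<close>

lemma tabloid_hook_eq_iff:
  assumes s: "filling (hook a k) s" and t: "filling (hook a k) t"
  shows "tabloid (hook a k) s = tabloid (hook a k) t \<longleftrightarrow> (\<forall>i\<in>{1..k}. s (i, 0) = t (i, 0))"
proof
  assume "tabloid (hook a k) s = tabloid (hook a k) t"
  then have "s ` diagram_row (hook a k) i = t ` diagram_row (hook a k) i" for i
    using tabloid_eq_iff[OF s] by blast
  from this show "\<forall>i\<in>{1..k}. s (i, 0) = t (i, 0)"
    by (force simp: diagram_row_hook split: if_splits)
next
  assume eq: "\<forall>i\<in>{1..k}. s (i, 0) = t (i, 0)"
  let ?L = "(\<lambda>i. (i, 0)) ` {1..k}"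
  have row0: "u ` (Pair 0 ` {..a}) = {1..sum_list (hook a k)} - u ` ?L"
    if u: "filling (hook a k) u" for u
  proof -
    have "{..k} = insert 0 {1..k}" by auto
    then have "leg k = insert (0, 0) ?L" by (simp only: image_insert)
    then have "Pair 0 ` {..a} = young_diagram (hook a k) - ?L"
      unfolding young_diagram_hook by auto
    moreover have "u ` (young_diagram (hook a k) - ?L) = u ` young_diagram (hook a k) - u ` ?L"
      using u by (intro inj_on_image_set_diff[of _ "young_diagram (hook a k)"])
        (auto simp: bij_betw_def young_diagram_hook)
    ultimately show ?thesis using u by (simp only: bij_betw_def)
  qed
  have "s ` ?L = t ` ?L" using eq by (intro image_cong) auto
  with row0[OF s] row0[OF t] have "s ` (Pair 0 ` {..a}) = t ` (Pair 0 ` {..a})" by simp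
  with eq show "tabloid (hook a k) s = tabloid (hook a k) t"
    unfolding tabloid_eq_iff[OF s] by (auto simp: diagram_row_hook)
qed

text \<open>All columns but the first are single boxes, so a column-preserving permutation fixes the
  entries outside the first column.\<close>

lemma col_stabilizer_hook:
  assumes "filling (hook a k) t"
  shows "col_stabilizer (hook a k) t = {\<pi>. \<pi> permutes t ` leg k}"
proof (intro equalityI subsetI CollectI)
  let ?n = "sum_list (hook a k)"
  have img: "t ` young_diagram (hook a k) = {1..?n}"
    using assms by (auto simp: bij_betw_def)
  fix \<pi> assume "\<pi> \<in> col_stabilizer (hook a k) t"
  then have p: "\<pi> permutes {1..?n}"
    and cols: "\<And>j. \<pi> ` t ` diagram_col (hook a k) j = t ` diagram_col (hook a k) j"
    by (auto simp: col_stabilizer_def)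
  show "\<pi> permutes t ` leg k"
  proof (rule permutes_superset[OF p])
    fix x assume "x \<in> {1..?n} - t ` leg k"
    with img obtain c where c: "c \<in> young_diagram (hook a k)" "c \<notin> leg k" "x = t c" by blast
    then obtain j where "j \<noteq> 0" "j \<le> a" "c = (0, j)" by (auto simp: young_diagram_hook)
    with cols[of j] c(3) show "\<pi> x = x" by (simp add: diagram_col_hook)
  qed
next
  let ?n = "sum_list (hook a k)"
  have img: "t ` young_diagram (hook a k) = {1..?n}" and inj: "inj_on t (young_diagram (hook a k))"
    using assms by (auto simp: bij_betw_def)
  fix \<pi> assume "\<pi> \<in> {\<pi>. \<pi> permutes t ` leg k}"
  then have p: "\<pi> permutes t ` leg k" by simp
  have "\<pi> permutes {1..?n}"
    using p image_mono[OF leg_subset, of t k a] unfolding img by (rule permutes_subset)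
  moreover have "\<pi> ` t ` diagram_col (hook a k) j = t ` diagram_col (hook a k) j" for j
  proof (cases "j = 0 \<or> j > a")
    case True
    then show ?thesis using permutes_image[OF p] by (auto simp: diagram_col_hook)
  next
    case False
    then have "(0, j) \<in> young_diagram (hook a k)" "(0, j) \<notin> leg k"
      by (auto simp: young_diagram_hook)
    then have "t (0, j) \<notin> t ` leg k"
      using inj_on_image_mem_iff[OF inj _ leg_subset] by blast
    with False show ?thesis using permutes_not_in[OF p] by (simp add: diagram_col_hook)
  qed
  ultimately show "\<pi> \<in> col_stabilizer (hook a k) t" by (simp add: col_stabilizer_def)
qed

lemma polytabloid_hook:
  assumes "filling (hook a k) t"
  shows "polytabloid (hook a k) t T =
    (\<Sum>\<pi> | \<pi> permutes t ` leg k. if tabloid (hook a k) (\<pi> \<circ> t) = T then of_int (sign \<pi>) else 0)"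
  by (simp add: polytabloid_def col_stabilizer_hook[OF assms])

lemma permutes_leg_imp_permutes:
  assumes "filling (hook a k) t" "\<pi> permutes t ` leg k"
  shows "\<pi> permutes {1..sum_list (hook a k)}"
  using assms(1) image_mono[OF leg_subset, of t k a] permutes_subset[OF assms(2)]
  by (simp add: bij_betw_def)

text \<open>Rearranging the first column amounts to substituting \<pi> \<circ> \<sigma> for \<pi> in
  the alternating sum. The order of the arm entries is invisible to tabloids.\<close>

lemma polytabloid_hook_permute:
  assumes t: "filling (hook a k) t" and t': "filling (hook a k) t'"
    and \<sigma>: "\<sigma> permutes t ` leg k"
    and eq: "\<And>i. i \<le> k \<Longrightarrow> t' (i, 0) = \<sigma> (t (i, 0))"
  shows "polytabloid (hook a k) t' = cscale (of_int (sign \<sigma>)) (polytabloid (hook a k) t)"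
proof
  fix T
  let ?C = "t ` leg k"
  have "t' ` leg k = \<sigma> ` t ` leg k"
    unfolding image_image by (rule image_cong) (auto simp: eq)
  then have C: "t' ` leg k = ?C" using permutes_image[OF \<sigma>] by simp
  let ?f = "\<lambda>\<pi>. if tabloid (hook a k) (\<pi> \<circ> t) = T then of_int (sign \<pi>) else (0 :: complex)"
  have f: "?f (\<pi> \<circ> \<sigma>) = of_int (sign \<sigma>) *
      (if tabloid (hook a k) (\<pi> \<circ> t') = T then of_int (sign \<pi>) else 0)"
    if p: "\<pi> permutes ?C" for \<pi>
  proof -
    have "tabloid (hook a k) (\<pi> \<circ> t') = tabloid (hook a k) (\<pi> \<circ> (\<sigma> \<circ> t))"
    proof (subst tabloid_hook_eq_iff)
      note ps = permutes_leg_imp_permutes[OF t p] permutes_leg_imp_permutes[OF t \<sigma>]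
      show "filling (hook a k) (\<pi> \<circ> t')" by (rule filling_compose[OF ps(1) t'])
      show "filling (hook a k) (\<pi> \<circ> (\<sigma> \<circ> t))"
        by (rule filling_compose[OF ps(1) filling_compose[OF ps(2) t]])
    qed (simp add: eq)
    moreover have "sign (\<pi> \<circ> \<sigma>) = sign \<pi> * sign \<sigma>"
      using p \<sigma> by (intro sign_compose permutes_imp_permutation[of ?C]) auto
    ultimately show ?thesis by (simp add: comp_assoc)
  qed
  have "polytabloid (hook a k) t T = (\<Sum>\<pi> | \<pi> permutes ?C. ?f (\<pi> \<circ> \<sigma>))"
    unfolding polytabloid_hook[OF t] by (rule sum_permutations_compose_right[OF \<sigma>])
  also have "\<dots> = of_int (sign \<sigma>) * polytabloid (hook a k) t' T"
    unfolding polytabloid_hook[OF t'] C sum_distrib_left by (rule sum.cong) (auto simp: f)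
  finally have "polytabloid (hook a k) t T = of_int (sign \<sigma>) * polytabloid (hook a k) t' T" .
  \<comment> \<open>The sign is its own inverse, which moves the factor to the other side.\<close>
  moreover have "of_int (sign \<sigma>) * of_int (sign \<sigma>) = (1 :: complex)"
    by (simp flip: of_int_mult)
  ultimately show "polytabloid (hook a k) t' T = cscale (of_int (sign \<sigma>)) (polytabloid (hook a k) t) T"
    by (metis cscale_def mult.assoc mult_1)
qed

section \<open>The Garnir relation for hooks\<close>

lemma sum_apply: "sum f A x = (\<Sum>a\<in>A. f a x)"
  by (induction A rule: infinite_finite_induct) auto

lemma permutes_transpose_conjugate:
  assumes "p permutes S"
  shows "transpose x y \<circ> p \<circ> transpose x y permutes transpose x y ` S"
proof (rule bij_imp_permutes)
  have "bij_betw (transpose x y) A (transpose x y ` A)" for A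
    by (simp add: inj_on_imp_bij_betw)
  from this[of S] this[of "transpose x y ` S"]
  have "bij_betw (transpose x y) S (transpose x y ` S)" "bij_betw (transpose x y) (transpose x y ` S) S"
    by (simp_all add: image_image)
  with permutes_imp_bij[OF assms]
  show "bij_betw (transpose x y \<circ> p \<circ> transpose x y) (transpose x y ` S) (transpose x y ` S)"
    by (metis bij_betw_trans)
  show "(transpose x y \<circ> p \<circ> transpose x y) z = z" if "z \<notin> transpose x y ` S" for z
  proof -
    have "transpose x y z \<notin> S" using that by (metis image_eqI transpose_involutory)
    then show ?thesis using permutes_not_in[OF assms] by simp
  qed
qed

text \<open>The new first column has \<open>d\<close> in place of \<open>b\<close>; conjugation by
  the transposition identifies the two symmetric groups and preserves signs. The result is a sum
  over one coset of the old column group, as it occurs in the Garnir relation.\<close>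

lemma polytabloid_hook_transpose:
  assumes t: "filling (hook a k) t" and b: "b \<in> t ` leg k"
    and d: "d \<in> {1..sum_list (hook a k)}" "d \<notin> t ` leg k"
  shows "polytabloid (hook a k) (transpose d b \<circ> t) T = (\<Sum>\<pi> | \<pi> permutes t ` leg k.
    if tabloid (hook a k) (transpose d b \<circ> \<pi> \<circ> t) = T then of_int (sign \<pi>) else 0)"
proof -
  let ?\<tau> = "transpose d b" and ?C = "t ` leg k"
  have C: "(?\<tau> \<circ> t) ` leg k = ?\<tau> ` ?C" by (simp only: image_comp comp_assoc)
  have \<tau>: "?\<tau> permutes {1..sum_list (hook a k)}"
  proof (rule permutes_swap_id[OF d(1)])
    show "b \<in> {1..sum_list (hook a k)}"
      using b bij_betw_imp_surj_on[OF t] leg_subset[of k a] by blast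
  qed
  have invol: "?\<tau> \<circ> ?\<tau> = id" by simp
  show ?thesis
    unfolding polytabloid_hook[OF filling_compose[OF \<tau> t]] C
  proof (rule sum.reindex_bij_witness[where i = "\<lambda>p. ?\<tau> \<circ> p \<circ> ?\<tau>" and j = "\<lambda>p. ?\<tau> \<circ> p \<circ> ?\<tau>"])
    fix p assume p: "p \<in> {p. p permutes ?\<tau> ` ?C}"
    then show "?\<tau> \<circ> (?\<tau> \<circ> p \<circ> ?\<tau>) \<circ> ?\<tau> = p" by (simp add: fun_eq_iff)
    have "?\<tau> ` ?\<tau> ` ?C = ?C" by (simp add: image_image)
    then show "?\<tau> \<circ> p \<circ> ?\<tau> \<in> {p. p permutes ?C}"
      using permutes_transpose_conjugate[of p "?\<tau> ` ?C" d b] p by simp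
    have "permutation p" using p by (auto intro: permutes_imp_permutation[of "?\<tau> ` ?C"])
    then have "sign (?\<tau> \<circ> p \<circ> ?\<tau>) = sign p"
      by (simp add: sign_compose permutation_compose permutation_swap_id sign_swap_id)
    moreover have "?\<tau> \<circ> (?\<tau> \<circ> p \<circ> ?\<tau>) \<circ> t = p \<circ> (?\<tau> \<circ> t)" by (simp add: fun_eq_iff)
    ultimately show "(if tabloid (hook a k) (?\<tau> \<circ> (?\<tau> \<circ> p \<circ> ?\<tau>) \<circ> t) = T
        then of_int (sign (?\<tau> \<circ> p \<circ> ?\<tau>)) else 0) =
      (if tabloid (hook a k) (p \<circ> (?\<tau> \<circ> t)) = T then of_int (sign p) else (0 :: complex))"
      by simp
  next
    fix p assume p: "p \<in> {p. p permutes ?C}"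
    then show "?\<tau> \<circ> (?\<tau> \<circ> p \<circ> ?\<tau>) \<circ> ?\<tau> = p" by (simp add: fun_eq_iff)
    show "?\<tau> \<circ> p \<circ> ?\<tau> \<in> {p. p permutes ?\<tau> ` ?C}"
      using permutes_transpose_conjugate[of p ?C d b] p by simp
  qed
qed

text \<open>The Garnir relation for hooks. The alternating sum over all permutations of the first
  column together with one further entry \<open>d\<close> of the first row vanishes, since \<open>d\<close> and the
  corner entry share a row; splitting it over the image of \<open>d\<close> gives the relation.\<close>

lemma garnir_hook:
  assumes t: "filling (hook a k) t" and d: "d \<in> {1..sum_list (hook a k)}" "d \<notin> t ` leg k"
  shows "polytabloid (hook a k) t =
    (\<Sum>b\<in>t ` leg k. polytabloid (hook a k) (transpose d b \<circ> t))"
proof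
  fix T
  let ?C = "t ` leg k" and ?c = "t (0, 0)"
  let ?f = "\<lambda>\<pi>. if tabloid (hook a k) (\<pi> \<circ> t) = T then of_int (sign \<pi>) else (0 :: complex)"
  have c: "?c \<in> ?C" by auto
  have C_sub: "?C \<subseteq> {1..sum_list (hook a k)}"
    using bij_betw_imp_surj_on[OF t] leg_subset by blast
  have fin: "finite ?C" by simp
  have \<sigma>: "transpose d ?c permutes insert d ?C"
    using c by (intro permutes_swap_id) auto
  have flip: "?f (\<pi> \<circ> transpose d ?c) = - ?f \<pi>" if \<pi>: "\<pi> permutes insert d ?C" for \<pi>
  proof -
    have ext: "\<rho> permutes {1..sum_list (hook a k)}" if "\<rho> permutes insert d ?C" for \<rho>
      using that by (rule permutes_subset) (use d C_sub in auto)
    have "transpose d ?c (t (i, 0)) = t (i, 0)" if "i \<in> {1..k}" for i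
    proof -
      have "t (i, 0) \<noteq> d" using d that by auto
      moreover have "t (i, 0) \<noteq> ?c"
        using inj_onD[OF bij_betw_imp_inj_on[OF t], of "(i, 0)" "(0, 0)"] that
        by (auto simp: young_diagram_hook)
      ultimately show ?thesis by (simp add: transpose_def)
    qed
    then have "tabloid (hook a k) (\<pi> \<circ> transpose d ?c \<circ> t) = tabloid (hook a k) (\<pi> \<circ> t)"
      by (subst tabloid_hook_eq_iff[OF filling_compose[OF ext[OF permutes_compose[OF \<sigma> \<pi>]] t]
            filling_compose[OF ext[OF \<pi>] t]]) simp
    moreover have "sign (\<pi> \<circ> transpose d ?c) = - sign \<pi>"
    proof -
      have "permutation \<pi>" using \<pi> by (rule permutes_imp_permutation[rotated]) simp
      moreover have "d \<noteq> ?c" using c d by blast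
      ultimately show ?thesis by (simp add: sign_compose permutation_swap_id sign_swap_id)
    qed
    ultimately show ?thesis by simp
  qed
  \<comment> \<open>Composition with the transposition of \<open>d\<close> and the corner entry
    permutes the summands and negates each of them, so the sum equals its own negative.\<close>
  have "(\<Sum>\<pi> | \<pi> permutes insert d ?C. ?f \<pi>) = (\<Sum>\<pi> | \<pi> permutes insert d ?C. ?f (\<pi> \<circ> transpose d ?c))"
    by (rule sum_permutations_compose_right[OF \<sigma>])
  also have "\<dots> = - (\<Sum>\<pi> | \<pi> permutes insert d ?C. ?f \<pi>)"
    unfolding sum_negf[symmetric] by (rule sum.cong) (simp_all only: mem_Collect_eq flip)
  finally have "(\<Sum>\<pi> | \<pi> permutes insert d ?C. ?f \<pi>) = 0" by simp
  \<comment> \<open>Every permutation of the enlarged set factors uniquely as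
    \<open>transpose d b \<circ> \<pi>\<close>, where \<open>b\<close> is the image of
    \<open>d\<close>. The term for \<open>b = d\<close> is the polytabloid of \<open>t\<close>; all
    others acquire a sign.\<close>
  then have "0 = (\<Sum>b\<in>insert d ?C. \<Sum>\<pi> | \<pi> permutes ?C. ?f (transpose d b \<circ> \<pi>))"
    unfolding sum_over_permutations_insert[OF fin d(2)] by simp
  also have "\<dots> = (\<Sum>\<pi> | \<pi> permutes ?C. ?f \<pi>) +
      (\<Sum>b\<in>?C. \<Sum>\<pi> | \<pi> permutes ?C. ?f (transpose d b \<circ> \<pi>))"
    using fin d(2) by (subst sum.insert) (simp_all cong: if_cong)
  also have "(\<Sum>b\<in>?C. \<Sum>\<pi> | \<pi> permutes ?C. ?f (transpose d b \<circ> \<pi>)) =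
      (\<Sum>b\<in>?C. - polytabloid (hook a k) (transpose d b \<circ> t) T)"
  proof (rule sum.cong[OF refl])
    fix b assume b: "b \<in> ?C"
    have "sign (transpose d b \<circ> \<pi>) = - sign \<pi>" if "\<pi> permutes ?C" for \<pi>
    proof -
      have "permutation \<pi>" using that by (rule permutes_imp_permutation[rotated]) simp
      moreover have "d \<noteq> b" using b d by blast
      ultimately show ?thesis by (simp add: sign_compose permutation_swap_id sign_swap_id)
    qed
    then show "(\<Sum>\<pi> | \<pi> permutes ?C. ?f (transpose d b \<circ> \<pi>)) =
        - polytabloid (hook a k) (transpose d b \<circ> t) T"
      unfolding polytabloid_hook_transpose[OF t b d] sum_negf[symmetric]
      by (intro sum.cong) auto
  qed
  also have "(\<Sum>\<pi> | \<pi> permutes ?C. ?f \<pi>) = polytabloid (hook a k) t T"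
    by (rule polytabloid_hook[OF t, symmetric])
  finally have "0 = polytabloid (hook a k) t T -
      (\<Sum>b\<in>?C. polytabloid (hook a k) (transpose d b \<circ> t) T)"
    by (simp only: sum_negf add_uminus_conv_diff)
  from this[symmetric] show "polytabloid (hook a k) t T =
      (\<Sum>b\<in>?C. polytabloid (hook a k) (transpose d b \<circ> t)) T"
    by (simp only: sum_apply right_minus_eq)
qed

section \<open>The dimension of the hook representations\<close>

text \<open>A standard tableau of hook shape has 1 in the corner and is determined by the set
  \<open>X\<close> of entries below it. The order inside leg and arm is left open, as it affects the
  polytabloid at most by a sign.\<close>

definition standard_fillings :: "nat \<Rightarrow> nat \<Rightarrow> (nat set \<Rightarrow> nat \<times> nat \<Rightarrow> nat) \<Rightarrow> bool" where
  "standard_fillings a k u \<longleftrightarrow> (\<forall>X. X \<subseteq> {2..Suc (a + k)} \<longrightarrow> card X = k \<longrightarrow>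
     filling (hook a k) (u X) \<and> u X (0, 0) = 1 \<and> u X ` (\<lambda>i. (i, 0)) ` {1..k} = X)"

lemma leg_conv_insert: "leg k = insert (0, 0) ((\<lambda>i. (i, 0)) ` {1..k})"
proof -
  have "{..k} = insert 0 {1..k}" by auto
  then show ?thesis by (simp only: image_insert)
qed

lemma standard_fillings_exist: obtains u where "standard_fillings a k u"
proof -
  have "\<exists>t. filling (hook a k) t \<and> t (0, 0) = 1 \<and> t ` (\<lambda>i. (i, 0)) ` {1..k} = X"
    if X: "X \<subseteq> {2..Suc (a + k)}" "card X = k" for X
  proof -
    let ?L = "(\<lambda>i. (i, 0 :: nat)) ` {1..k}" and ?A = "Pair (0 :: nat) ` {1..a}"
    have fin: "finite X" using X(1) finite_subset by blast
    have "card ?L = card X" using X(2) by (simp add: card_image inj_on_def)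
    then obtain g where g: "bij_betw g ?L X"
      using finite_same_card_bij[of ?L X] fin by auto
    \<comment> \<open>Of the \<open>a + k\<close> entries other than 1, exactly \<open>a\<close>
      remain for the arm.\<close>
    have "card ?A = card ({2..Suc (a + k)} - X)"
      using X fin by (simp add: card_image inj_on_def card_Diff_subset)
    then obtain h where h: "bij_betw h ?A ({2..Suc (a + k)} - X)"
      using finite_same_card_bij[of ?A "{2..Suc (a + k)} - X"] by auto
    define t where "t c = (if c = (0, 0) then 1 else if c \<in> ?L then g c else h c)" for c
    have "bij_betw t ?L X \<longleftrightarrow> bij_betw g ?L X" by (rule bij_betw_cong) (auto simp: t_def)
    with g have tL: "bij_betw t ?L X" by simp
    have "bij_betw t ?A ({2..Suc (a + k)} - X) \<longleftrightarrow> bij_betw h ?A ({2..Suc (a + k)} - X)"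
      by (rule bij_betw_cong) (auto simp: t_def)
    with h have tA: "bij_betw t ?A ({2..Suc (a + k)} - X)" by simp
    have t0: "bij_betw t {(0, 0)} {1}" by (simp add: t_def bij_betw_def)
    have "bij_betw t (({(0, 0)} \<union> ?L) \<union> ?A) (({1} \<union> X) \<union> ({2..Suc (a + k)} - X))"
      using X by (intro bij_betw_combine t0 tL tA) auto
    moreover have "({(0, 0)} \<union> ?L) \<union> ?A = young_diagram (hook a k)"
    proof -
      have "{..a} = insert 0 {1..a}" by auto
      then have "Pair (0 :: nat) ` {..a} = insert (0, 0) ?A" by (simp only: image_insert)
      then show ?thesis unfolding young_diagram_hook leg_conv_insert by auto
    qed
    moreover have "({1} \<union> X) \<union> ({2..Suc (a + k)} - X) = {1..sum_list (hook a k)}"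
      using X by (auto simp: sum_list_hook)
    ultimately have "filling (hook a k) t" by (simp only:)
    moreover have "t (0, 0) = 1" by (simp add: t_def)
    ultimately show ?thesis using bij_betw_imp_surj_on[OF tL] by blast
  qed
  then obtain u where "\<forall>X. X \<subseteq> {2..Suc (a + k)} \<longrightarrow> card X = k \<longrightarrow>
      filling (hook a k) (u X) \<and> u X (0, 0) = 1 \<and> u X ` (\<lambda>i. (i, 0)) ` {1..k} = X"
    by metis
  then show ?thesis using that by (simp only: standard_fillings_def)
qed

lemma standard_fillings_leg:
  assumes "standard_fillings a k u" "X \<subseteq> {2..Suc (a + k)}" "card X = k"
  shows "u X ` leg k = insert 1 X"
  using assms unfolding standard_fillings_def leg_conv_insert by simp

text \<open>The tabloids of the chosen fillings act as a dual system: a column permutation taking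
  the tabloid of \<open>u X\<close> to that of \<open>u Y\<close> maps \<open>X\<close> onto
  \<open>Y\<close>, which forces it to fix 1 and then every entry.\<close>

lemma polytabloid_standard_fillings:
  assumes u: "standard_fillings a k u"
    and X: "X \<subseteq> {2..Suc (a + k)}" "card X = k" and Y: "Y \<subseteq> {2..Suc (a + k)}" "card Y = k"
  shows "polytabloid (hook a k) (u X) (tabloid (hook a k) (u Y)) = (if X = Y then 1 else 0)"
proof -
  have uX: "filling (hook a k) (u X)" "u X (0, 0) = 1" "u X ` (\<lambda>i. (i, 0)) ` {1..k} = X"
    and uY: "filling (hook a k) (u Y)" "u Y ` (\<lambda>i. (i, 0)) ` {1..k} = Y"
    using u X Y by (auto simp: standard_fillings_def)
  have leg: "u X ` leg k = insert 1 X" by (rule standard_fillings_leg[OF u X])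
  have n1: "1 \<notin> X" "1 \<notin> Y" using X(1) Y(1) by auto
  have fin: "finite X" using X(1) finite_subset by blast
  have "tabloid (hook a k) (\<pi> \<circ> u X) = tabloid (hook a k) (u Y) \<longleftrightarrow> X = Y \<and> \<pi> = id"
    if \<pi>: "\<pi> permutes insert 1 X" for \<pi>
  proof -
    have p: "\<pi> permutes {1..sum_list (hook a k)}"
      using permutes_leg_imp_permutes[OF uX(1)] \<pi> unfolding leg by blast
    show ?thesis
    proof
      assume "tabloid (hook a k) (\<pi> \<circ> u X) = tabloid (hook a k) (u Y)"
      then have eq: "\<pi> (u X (i, 0)) = u Y (i, 0)" if "i \<in> {1..k}" for i
        using that by (simp add: tabloid_hook_eq_iff[OF filling_compose[OF p uX(1)] uY(1)])
      have "\<pi> ` X = \<pi> ` u X ` (\<lambda>i. (i, 0)) ` {1..k}" by (simp only: uX(3))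
      also have "\<dots> = u Y ` (\<lambda>i. (i, 0)) ` {1..k}"
        unfolding image_image by (rule image_cong) (simp_all only: eq)
      finally have "\<pi> ` X = Y" by (simp only: uY(2))
      \<comment> \<open>The column \<open>insert 1 X\<close> is mapped onto itself, and 1 is not in
        \<open>Y\<close>, so 1 can only be the image of 1.\<close>
      with permutes_image[OF \<pi>] have ins: "insert (\<pi> 1) Y = insert 1 X" by (simp only: image_insert)
      have "1 \<in> insert (\<pi> 1) Y" unfolding ins by (rule insertI1)
      with n1(2) have \<pi>1: "\<pi> 1 = 1" by (metis insertE)
      with ins have "insert 1 Y = insert 1 X" by (simp only:)
      then have XY: "X = Y" using insert_ident[OF n1(2,1)] by simp
      have "\<pi> x = x" for x
      proof (cases "x \<in> X")
        case True
        then obtain i where "i \<in> {1..k}" "x = u X (i, 0)" using uX(3) by blast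
        with eq[of i] XY show ?thesis by simp
      next
        case False
        then show ?thesis using \<pi>1 permutes_not_in[OF \<pi>] by (cases "x = 1") auto
      qed
      with XY show "X = Y \<and> \<pi> = id" by auto
    qed simp
  qed
  then have "polytabloid (hook a k) (u X) (tabloid (hook a k) (u Y)) =
      (\<Sum>\<pi> | \<pi> permutes insert 1 X. if \<pi> = id then if X = Y then 1 else 0 else 0)"
    unfolding polytabloid_hook[OF uX(1)] leg by (intro sum.cong) auto
  also have "\<dots> = (if X = Y then 1 else 0)"
    using finite_permutations[of "insert 1 X"] fin by (subst sum.delta) (simp_all add: permutes_id)
  finally show ?thesis .
qed

text \<open>If 1 is in the first column, the filling differs from some \<open>u X\<close> by a
  column permutation, up to the arm. Otherwise the Garnir relation with \<open>d = 1\<close> brings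
  1 into the first column in every term.\<close>

lemma polytabloid_hook_in_span:
  assumes u: "standard_fillings a k u" and t: "filling (hook a k) t"
  shows "polytabloid (hook a k) t \<in>
    cfun.span ((\<lambda>X. polytabloid (hook a k) (u X)) ` {X. X \<subseteq> {2..Suc (a + k)} \<and> card X = k})"
    (is "_ \<in> cfun.span ?B")
proof -
  have *: "polytabloid (hook a k) t \<in> cfun.span ?B"
    if t: "filling (hook a k) t" and one: "1 \<in> t ` leg k" for t
  proof -
    let ?C = "t ` leg k"
    define X where "X = ?C - {1}"
    have inj: "inj_on t (leg k)"
      using bij_betw_imp_inj_on[OF t] leg_subset by (rule inj_on_subset)
    have "?C \<subseteq> {1..Suc (a + k)}"
      using bij_betw_imp_surj_on[OF t] leg_subset unfolding sum_list_hook by blast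
    then have X1: "X \<subseteq> {2..Suc (a + k)}" by (force simp: X_def)
    have "card ?C = Suc k" using inj by (simp add: card_image inj_on_def)
    then have X2: "card X = k" using one by (simp add: X_def)
    have uX: "filling (hook a k) (u X)" using u X1 X2 by (simp add: standard_fillings_def)
    have leg: "u X ` leg k = ?C"
      using standard_fillings_leg[OF u X1 X2] one by (auto simp: X_def)
    have injX: "inj_on (u X) (leg k)"
      using bij_betw_imp_inj_on[OF uX] leg_subset by (rule inj_on_subset)
    \<comment> \<open>Sends the entry of \<open>u X\<close> in each box of the first column to the
      entry of \<open>t\<close> in the same box.\<close>
    define \<sigma> where "\<sigma> x = (if x \<in> ?C then t (inv_into (leg k) (u X) x) else x)" for x
    have "bij_betw (inv_into (leg k) (u X)) ?C (leg k)"
      using injX leg by (intro bij_betw_inv_into) (simp add: bij_betw_def)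
    then have "bij_betw (t \<circ> inv_into (leg k) (u X)) ?C ?C"
      using inj by (rule bij_betw_trans[OF _ inj_on_imp_bij_betw])
    moreover have "bij_betw \<sigma> ?C ?C \<longleftrightarrow> bij_betw (t \<circ> inv_into (leg k) (u X)) ?C ?C"
      by (rule bij_betw_cong) (simp add: \<sigma>_def)
    ultimately have "\<sigma> permutes ?C" by (intro bij_imp_permutes) (auto simp: \<sigma>_def)
    then have \<sigma>: "\<sigma> permutes u X ` leg k" by (simp only: leg)
    have "t (i, 0) = \<sigma> (u X (i, 0))" if "i \<le> k" for i
    proof -
      have "u X (i, 0) \<in> ?C" using that leg by blast
      moreover have "inv_into (leg k) (u X) (u X (i, 0)) = (i, 0)"
        using that by (intro inv_into_f_f[OF injX]) auto
      ultimately show ?thesis by (simp add: \<sigma>_def)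
    qed
    then have "polytabloid (hook a k) t = cscale (of_int (sign \<sigma>)) (polytabloid (hook a k) (u X))"
      by (rule polytabloid_hook_permute[OF uX t \<sigma>])
    moreover have "polytabloid (hook a k) (u X) \<in> cfun.span ?B"
      using X1 X2 by (intro cfun.span_base) auto
    ultimately show ?thesis by (simp only: cfun.span_scale)
  qed
  show ?thesis
  proof (cases "1 \<in> t ` leg k")
    case True
    then show ?thesis by (rule *[OF t])
  next
    case False
    have d: "1 \<in> {1..sum_list (hook a k)}" by (simp add: sum_list_hook)
    have "polytabloid (hook a k) (transpose 1 b \<circ> t) \<in> cfun.span ?B" if b: "b \<in> t ` leg k" for b
    proof (rule *)
      have "b \<in> {1..sum_list (hook a k)}"
        using b bij_betw_imp_surj_on[OF t] leg_subset by blast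
      then show "filling (hook a k) (transpose 1 b \<circ> t)"
        using d by (intro filling_compose[OF _ t] permutes_swap_id)
      show "1 \<in> (transpose 1 b \<circ> t) ` leg k"
        using b by (auto simp: image_iff intro!: bexI)
    qed
    then show ?thesis unfolding garnir_hook[OF t d False] by (intro cfun.span_sum)
  qed
qed

text \<open>The polytabloids of the chosen fillings form a basis, indexed by the
  \<open>k\<close>-subsets of a set with \<open>a + k\<close> elements.\<close>

theorem irrep_dim_hook: "irrep_dim (hook a k) = (a + k) choose k"
proof -
  obtain u where u: "standard_fillings a k u" by (rule standard_fillings_exist)
  let ?Xs = "{X. X \<subseteq> {2..Suc (a + k)} \<and> card X = k}"
  let ?e = "\<lambda>X. polytabloid (hook a k) (u X)" and ?T = "\<lambda>X. tabloid (hook a k) (u X)"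
  have eT: "?e X (?T Y) = (if X = Y then 1 else 0)" if "X \<in> ?Xs" "Y \<in> ?Xs" for X Y
    using polytabloid_standard_fillings[OF u] that by simp
  have fin: "finite ?Xs" by simp
  have inj: "inj_on ?e ?Xs"
  proof (rule inj_onI)
    fix X Y assume "X \<in> ?Xs" "Y \<in> ?Xs" "?e X = ?e Y"
    with eT[of X X] eT[of Y X] show "X = Y" by (metis one_neq_zero)
  qed
  have "cfun.independent (?e ` ?Xs)"
  proof (rule cfun.independent_if_scalars_zero)
    show "finite (?e ` ?Xs)" using fin by simp
    fix f v assume 0: "(\<Sum>v\<in>?e ` ?Xs. cscale (f v) v) = 0" and "v \<in> ?e ` ?Xs"
    then obtain Y where Y: "Y \<in> ?Xs" "v = ?e Y" by blast
    \<comment> \<open>Evaluating the linear relation at the tabloid of \<open>u Y\<close> isolates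
      the coefficient of \<open>?e Y\<close>.\<close>
    have "(\<Sum>X\<in>?Xs. f (?e X) * ?e X (?T Y)) = (\<Sum>v\<in>?e ` ?Xs. cscale (f v) v) (?T Y)"
      unfolding sum_apply sum.reindex[OF inj] by (simp add: cscale_def)
    also have "\<dots> = 0" by (simp add: 0)
    also have "(\<Sum>X\<in>?Xs. f (?e X) * ?e X (?T Y)) = (\<Sum>X\<in>?Xs. if X = Y then f (?e Y) else 0)"
      using Y(1) eT by (intro sum.cong) auto
    also have "\<dots> = f v" using Y fin by simp
    finally show "f v = 0" .
  qed
  moreover have "cfun.span (?e ` ?Xs) = cfun.span (polytabloid (hook a k) ` tableaux (hook a k))"
  proof (intro equalityI cfun.span_minimal cfun.subspace_span image_subsetI)
    fix t assume "t \<in> tableaux (hook a k)"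
    then show "polytabloid (hook a k) t \<in> cfun.span (?e ` ?Xs)"
      by (intro polytabloid_hook_in_span[OF u]) (simp add: tableaux_def)
  next
    fix X assume "X \<in> ?Xs"
    then have "filling (hook a k) (u X)" using u by (simp add: standard_fillings_def)
    then have "restrict (u X) (young_diagram (hook a k)) \<in> tableaux (hook a k)"
      by (rule restrict_in_tableaux)
    moreover have "?e X = polytabloid (hook a k) (restrict (u X) (young_diagram (hook a k)))"
      by (rule polytabloid_cong) simp
    ultimately show "?e X \<in> cfun.span (polytabloid (hook a k) ` tableaux (hook a k))"
      by (intro cfun.span_base) auto
  qed
  ultimately have "irrep_dim (hook a k) = card (?e ` ?Xs)"
    unfolding irrep_dim_def specht_module_def by (intro cfun.dim_eq_card) (simp_all add: cfun.span_span)
  also have "\<dots> = card ?Xs" by (rule card_image[OF inj])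
  also have "\<dots> = (a + k) choose k" by (subst n_subsets) simp_all
  finally show ?thesis .
qed

section \<open>Small vertices of the Macdonald tree\<close>

lemma card_young_diagram: "card (young_diagram \<mu>) = sum_list \<mu>"
proof -
  have "young_diagram \<mu> = (SIGMA i:{..<length \<mu>}. {..<\<mu> ! i})"
    by (auto simp: young_diagram_def)
  then show ?thesis by (simp add: sum_list_sum_nth atLeast0LessThan)
qed

lemma finite_young_diagram: "finite (young_diagram \<mu>)"
proof -
  have "young_diagram \<mu> \<subseteq> (SIGMA i:{..<length \<mu>}. {..<\<mu> ! i})"
    by (auto simp: young_diagram_def)
  then show ?thesis by (rule finite_subset) simp
qed

lemma adds_box_sum_list: "adds_box \<mu> \<nu> \<Longrightarrow> sum_list \<nu> = Suc (sum_list \<mu>)"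
  by (auto simp: adds_box_def finite_young_diagram simp flip: card_young_diagram)

lemma adds_box_hook: "adds_box (hook a k) (hook (Suc a) k)" "adds_box (hook a k) (hook a (Suc k))"
proof -
  show "adds_box (hook a k) (hook (Suc a) k)"
    unfolding adds_box_def young_diagram_hook
    by (intro exI[of _ "(0, Suc a)"]) (auto simp: atMost_Suc)
  show "adds_box (hook a k) (hook a (Suc k))"
    unfolding adds_box_def young_diagram_hook
    by (intro exI[of _ "(Suc k, 0)"]) (auto simp: atMost_Suc)
qed

lemma hook_eq_iff: "hook a k = hook b l \<longleftrightarrow> a = b \<and> k = l"
  by (auto simp: hook_def)

text \<open>Splitting off the largest part gives the recursion by which small partitions are
  enumerated.\<close>

lemma partition_of_Cons_iff:
  "partition_of n (x # \<mu>) \<longleftrightarrow> 0 < x \<and> x \<le> n \<and> partition_of (n - x) \<mu> \<and> (\<forall>y\<in>set \<mu>. y \<le> x)"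
  by (auto simp: partition_of_def)

lemma partition_of_hook: "partition_of (Suc (a + k)) (hook a k)"
proof -
  have "partition_of k (replicate k 1)"
    by (induction k) (auto simp: partition_of_Cons_iff partition_of_def)
  then show ?thesis by (simp add: hook_def partition_of_Cons_iff)
qed

lemma hook_odd_partition: "odd ((a + k) choose k) \<Longrightarrow> hook a k \<in> odd_partitions"
  using partition_of_hook[of a k] by (auto simp: odd_partitions_def irrep_dim_hook intro: Suc_leI)

lemma odd_partitionsD:
  assumes "\<mu> \<in> odd_partitions"
  shows "partition_of (sum_list \<mu>) \<mu>" "sum_list \<mu> > 0"
  using assms by (auto simp: odd_partitions_def partition_of_def)

section \<open>Partitions of size at most 3\<close>

lemma partition_of_0: "partition_of 0 \<mu> \<Longrightarrow> \<mu> = []"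
  by (cases \<mu>) (auto simp: partition_of_def)

lemma partition_of_1:
  assumes "partition_of 1 \<mu>"
  shows "\<mu> = hook 0 0"
proof (cases \<mu>)
  case (Cons x \<mu>')
  with assms show ?thesis
    using partition_of_0[of \<mu>'] by (auto simp: partition_of_Cons_iff hook_def le_Suc_eq)
qed (use assms in \<open>simp add: partition_of_def\<close>)

lemma partition_of_2:
  assumes "partition_of 2 \<mu>"
  shows "\<mu> = hook 1 0 \<or> \<mu> = hook 0 1"
proof (cases \<mu>)
  case (Cons x \<mu>')
  with assms have "x = 1 \<or> x = 2" and "partition_of (2 - x) \<mu>'"
    by (auto simp: partition_of_Cons_iff)
  then show ?thesis
    using Cons partition_of_0[of \<mu>'] partition_of_1[of \<mu>'] by (auto simp: hook_def)
qed (use assms in \<open>simp add: partition_of_def\<close>)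

lemma partition_of_3:
  assumes "partition_of 3 \<mu>"
  shows "\<mu> = hook 2 0 \<or> \<mu> = hook 1 1 \<or> \<mu> = hook 0 2"
proof (cases \<mu>)
  case (Cons x \<mu>')
  with assms have "x = 1 \<or> x = 2 \<or> x = 3" and "partition_of (3 - x) \<mu>'" "\<forall>y\<in>set \<mu>'. y \<le> x"
    by (auto simp: partition_of_Cons_iff)
  then show ?thesis
    using Cons partition_of_0[of \<mu>'] partition_of_1[of \<mu>'] partition_of_2[of \<mu>']
    by (auto simp: hook_def numeral_2_eq_2 numeral_3_eq_3)
qed (use assms in \<open>simp add: partition_of_def\<close>)

section \<open>Arcs and neighbourhoods in the Macdonald tree\<close>

lemma macdonald_tree_arc_sym: "(\<mu>, \<nu>) \<in> parcs macdonald_tree \<longleftrightarrow> (\<nu>, \<mu>) \<in> parcs macdonald_tree"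
  by (auto simp: macdonald_tree_def)

lemma macdonald_tree_arc_hook:
  assumes "odd ((a + k) choose k)"
  shows "odd ((Suc a + k) choose k) \<Longrightarrow> (hook a k, hook (Suc a) k) \<in> parcs macdonald_tree"
    and "odd ((a + Suc k) choose Suc k) \<Longrightarrow> (hook a k, hook a (Suc k)) \<in> parcs macdonald_tree"
  using assms hook_odd_partition adds_box_hook by (simp_all add: macdonald_tree_def)

text \<open>Of the partitions of size at most 3 only (2,1), which is \<open>hook 1 1\<close>, has
  even dimension, namely 2.\<close>

lemma odd_partitions_small:
  assumes "\<mu> \<in> odd_partitions"
  shows "sum_list \<mu> = 1 \<Longrightarrow> \<mu> = hook 0 0"
    and "sum_list \<mu> = 2 \<Longrightarrow> \<mu> = hook 1 0 \<or> \<mu> = hook 0 1"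
    and "sum_list \<mu> = 3 \<Longrightarrow> \<mu> = hook 2 0 \<or> \<mu> = hook 0 2"
proof -
  show "sum_list \<mu> = 1 \<Longrightarrow> \<mu> = hook 0 0" "sum_list \<mu> = 2 \<Longrightarrow> \<mu> = hook 1 0 \<or> \<mu> = hook 0 1"
    using odd_partitionsD[OF assms] partition_of_1[of \<mu>] partition_of_2[of \<mu>] by auto
  have "even (irrep_dim (hook 1 1))" by (simp add: irrep_dim_hook)
  then have "\<mu> \<noteq> hook 1 1" using assms by (auto simp: odd_partitions_def)
  then show "sum_list \<mu> = 3 \<Longrightarrow> \<mu> = hook 2 0 \<or> \<mu> = hook 0 2"
    using odd_partitionsD[OF assms] partition_of_3[of \<mu>] by auto
qed

lemma macdonald_tree_arc_cases:
  assumes "(\<mu>, \<nu>) \<in> parcs macdonald_tree"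
  shows "\<nu> \<in> odd_partitions"
    "sum_list \<nu> = Suc (sum_list \<mu>) \<and> young_diagram \<mu> \<subseteq> young_diagram \<nu> \<or>
     sum_list \<mu> = Suc (sum_list \<nu>)"
  using assms adds_box_sum_list[of \<mu> \<nu>] adds_box_sum_list[of \<nu> \<mu>]
  by (auto simp: macdonald_tree_def adds_box_def)

lemma neighbours_1: "{\<nu>. (hook 0 0, \<nu>) \<in> parcs macdonald_tree} = {hook 1 0, hook 0 1}"
proof (intro equalityI subsetI)
  fix \<nu> assume "\<nu> \<in> {\<nu>. (hook 0 0, \<nu>) \<in> parcs macdonald_tree}"
  then have "(hook 0 0, \<nu>) \<in> parcs macdonald_tree" by simp
  note arc = macdonald_tree_arc_cases[OF this]
  \<comment> \<open>There is no vertex of size 0, so the neighbours of (1) all lie above it.\<close>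
  then have "sum_list \<nu> = 2" using odd_partitionsD(2)[OF arc(1)]
    by (auto simp: sum_list_hook simp del: sum_list_eq_0_iff)
  then show "\<nu> \<in> {hook 1 0, hook 0 1}" using odd_partitions_small(2)[OF arc(1)] by simp
next
  fix \<nu> assume "\<nu> \<in> {hook 1 0, hook 0 1}"
  then show "\<nu> \<in> {\<nu>. (hook 0 0, \<nu>) \<in> parcs macdonald_tree}"
    using macdonald_tree_arc_hook[of 0 0] by auto
qed

lemma neighbours_2: "{\<nu>. (hook 1 0, \<nu>) \<in> parcs macdonald_tree} = {hook 0 0, hook 2 0}"
proof (intro equalityI subsetI)
  fix \<nu> assume "\<nu> \<in> {\<nu>. (hook 1 0, \<nu>) \<in> parcs macdonald_tree}"
  then have "(hook 1 0, \<nu>) \<in> parcs macdonald_tree" by simp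
  note arc = macdonald_tree_arc_cases[OF this]
  from arc(2) show "\<nu> \<in> {hook 0 0, hook 2 0}"
  proof
    assume up: "sum_list \<nu> = Suc (sum_list (hook 1 0)) \<and> young_diagram (hook 1 0) \<subseteq> young_diagram \<nu>"
    \<comment> \<open>The second box of the first row rules out (1,1,1), leaving (3) as the only
      upper neighbour of (2).\<close>
    then have "(0, 1) \<in> young_diagram \<nu>" by (auto simp: young_diagram_hook)
    then have "\<nu> \<noteq> hook 0 2" by (auto simp: young_diagram_hook)
    with up show ?thesis using odd_partitions_small(3)[OF arc(1)] by (auto simp: sum_list_hook)
  next
    assume "sum_list (hook 1 0) = Suc (sum_list \<nu>)"
    then show ?thesis using odd_partitions_small(1)[OF arc(1)] by (auto simp: sum_list_hook)
  qed
next
  fix \<nu> assume "\<nu> \<in> {hook 0 0, hook 2 0}"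
  then show "\<nu> \<in> {\<nu>. (hook 1 0, \<nu>) \<in> parcs macdonald_tree}"
    using macdonald_tree_arc_hook(1)[of 0 0] macdonald_tree_arc_hook(1)[of 1 0]
    by (auto simp: macdonald_tree_arc_sym[of "hook (Suc 0) 0" "hook 0 0"] numeral_2_eq_2)
qed

lemma neighbours_1_1: "{\<nu>. (hook 0 1, \<nu>) \<in> parcs macdonald_tree} = {hook 0 0, hook 0 2}"
proof (intro equalityI subsetI)
  fix \<nu> assume "\<nu> \<in> {\<nu>. (hook 0 1, \<nu>) \<in> parcs macdonald_tree}"
  then have "(hook 0 1, \<nu>) \<in> parcs macdonald_tree" by simp
  note arc = macdonald_tree_arc_cases[OF this]
  from arc(2) show "\<nu> \<in> {hook 0 0, hook 0 2}"
  proof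
    assume up: "sum_list \<nu> = Suc (sum_list (hook 0 1)) \<and> young_diagram (hook 0 1) \<subseteq> young_diagram \<nu>"
    \<comment> \<open>Transposed argument: the second box of the first column rules out (3).\<close>
    then have "(1, 0) \<in> young_diagram \<nu>" by (auto simp: young_diagram_hook)
    then have "\<nu> \<noteq> hook 2 0" by (auto simp: young_diagram_hook)
    with up show ?thesis using odd_partitions_small(3)[OF arc(1)] by (auto simp: sum_list_hook)
  next
    assume "sum_list (hook 0 1) = Suc (sum_list \<nu>)"
    then show ?thesis using odd_partitions_small(1)[OF arc(1)] by (auto simp: sum_list_hook)
  qed
next
  fix \<nu> assume "\<nu> \<in> {hook 0 0, hook 0 2}"
  then show "\<nu> \<in> {\<nu>. (hook 0 1, \<nu>) \<in> parcs macdonald_tree}"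
    using macdonald_tree_arc_hook(2)[of 0 0] macdonald_tree_arc_hook(2)[of 0 1]
    by (auto simp: macdonald_tree_arc_sym[of "hook 0 (Suc 0)" "hook 0 0"] numeral_2_eq_2)
qed

text \<open>Reduces the library notion, with separate maps on vertices and arcs, to a vertex
  bijection that carries neighbourhoods to neighbourhoods.\<close>

lemma digraph_iso_with_projD:
  assumes "digraph_iso (with_proj G) (with_proj H)" "pair_wf_digraph G"
  obtains f where "inj_on f (pverts G)" "pverts H = f ` pverts G"
    "\<forall>u\<in>pverts G. {w. (f u, w) \<in> parcs H} = f ` {v. (u, v) \<in> parcs G}"
proof -
  from assms(1) obtain h where h: "pre_digraph.digraph_isomorphism (with_proj G) h"
    and H: "with_proj H = app_iso h (with_proj G)"
    by (auto simp: digraph_iso_def)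
  let ?f = "iso_verts h"
  have inj: "inj_on ?f (pverts G)"
    using h by (simp add: pre_digraph.digraph_isomorphism_def)
  have verts: "pverts H = ?f ` pverts G"
    using arg_cong[OF H, of verts] by simp
  have arcs: "parcs H = iso_arcs h ` parcs G"
    using arg_cong[OF H, of arcs] by simp
  \<comment> \<open>Arcs of both digraphs are pairs with tail \<open>fst\<close> and head
    \<open>snd\<close>, so the vertex map determines the arc map.\<close>
  have "iso_tail h = fst" "iso_head h = snd"
    using arg_cong[OF H, of tail] arg_cong[OF H, of head] by simp_all
  then have "iso_arcs h a = (?f (fst a), ?f (snd a))" if "a \<in> parcs G" for a
    using h that by (simp add: pre_digraph.digraph_isomorphism_def prod_eq_iff)
  then have arcs': "parcs H = (\<lambda>a. (?f (fst a), ?f (snd a))) ` parcs G"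
    unfolding arcs by (rule image_cong[OF refl])
  have "{w. (?f u, w) \<in> parcs H} = ?f ` {v. (u, v) \<in> parcs G}" if "u \<in> pverts G" for u
  proof (intro equalityI subsetI)
    fix w assume "w \<in> {w. (?f u, w) \<in> parcs H}"
    then obtain x v where xv: "(x, v) \<in> parcs G" "?f u = ?f x" "w = ?f v"
      by (auto simp: arcs')
    then have "x = u"
      using inj_onD[OF inj xv(2) that] pair_wf_digraph.in_arcsD1[OF assms(2)] by auto
    with xv show "w \<in> ?f ` {v. (u, v) \<in> parcs G}" by auto
  qed (force simp: arcs')
  with inj verts that show ?thesis by blast
qed

theorem corollary4p4:
  shows "\<not> digraph_iso (with_proj macdonald_tree) (with_proj string_graph)"
proof
  assume "digraph_iso (with_proj macdonald_tree) (with_proj string_graph)"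
  then obtain f where inj: "inj_on f (pverts macdonald_tree)"
    and verts: "pverts string_graph = f ` pverts macdonald_tree"
    and "\<forall>u\<in>pverts macdonald_tree.
      {w. (f u, w) \<in> parcs string_graph} = f ` {v. (u, v) \<in> parcs macdonald_tree}"
    using pair_wf_digraph_macdonald_tree by (rule digraph_iso_with_projD)
  then have nbrs: "{w. (f u, w) \<in> parcs string_graph} = f ` {v. (u, v) \<in> parcs macdonald_tree}"
    if "u \<in> pverts macdonald_tree" for u
    using that by blast
  define g where "g a k = f (hook a k)" for a k
  have V: "hook a k \<in> pverts macdonald_tree" if "odd ((a + k) choose k)" for a k
    using hook_odd_partition[OF that] by (simp add: macdonald_tree_def)
  have gV: "g a k \<in> pverts string_graph" if "odd ((a + k) choose k)" for a k
    unfolding g_def verts using V[OF that] by (rule imageI)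
  have g_eq: "g a k = g b l \<longleftrightarrow> a = b \<and> k = l"
    if "odd ((a + k) choose k)" "odd ((b + l) choose l)" for a k b l
    using inj_on_eq_iff[OF inj V[OF that(1)] V[OF that(2)]] by (simp add: g_def hook_eq_iff)
  have arcR: "(g a k, g (Suc a) k) \<in> parcs string_graph"
    if "odd ((a + k) choose k)" "odd ((Suc a + k) choose k)" for a k
    using nbrs[OF V[OF that(1)]] macdonald_tree_arc_hook(1)[OF that] by (auto simp: g_def)
  have arcD: "(g a k, g a (Suc k)) \<in> parcs string_graph"
    if "odd ((a + k) choose k)" "odd ((a + Suc k) choose Suc k)" for a k
    using nbrs[OF V[OF that(1)]] macdonald_tree_arc_hook(2)[OF that] by (auto simp: g_def)
  have n1: "{w. (g 0 0, w) \<in> parcs string_graph} = {g 1 0, g 0 1}"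
    using nbrs[OF V, of 0 0] by (simp add: g_def neighbours_1)
  have n2: "{w. (g 1 0, w) \<in> parcs string_graph} = {g 0 0, g 2 0}"
    using nbrs[OF V, of 1 0] by (simp add: g_def neighbours_2 del: One_nat_def)
  have n11: "{w. (g 0 1, w) \<in> parcs string_graph} = {g 0 0, g 0 2}"
    using nbrs[OF V, of 0 1] by (simp add: g_def neighbours_1_1 del: One_nat_def)
  have deg: "card {U. (T, U) \<in> parcs string_graph} = 2" if "T \<in> {g 0 0, g 1 0, g 0 1}" for T
  proof -
    \<comment> \<open>Makes (1,1,1) a vertex, so that injectivity separates its image from that of
      (1).\<close>
    have "odd (0 + 2 choose 2 :: nat)" by (simp add: choose_two)
    then show ?thesis
      using that g_eq[of 1 0 0 1] g_eq[of 0 0 2 0] g_eq[of 0 0 0 2]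
      by (auto simp: n1 n2 n11 simp del: One_nat_def)
  qed
  have l1: "level (g 0 0) = 1"
  proof (rule level_one_if_degree_two)
    show "g 0 0 \<in> pverts string_graph" by (rule gV) simp
    show "card {T. (g 0 0, T) \<in> parcs string_graph} = 2" by (rule deg) simp
    fix T assume "(g 0 0, T) \<in> parcs string_graph"
    then have "T \<in> {g 1 0, g 0 1}" using n1 by blast
    then show "card {U. (T, U) \<in> parcs string_graph} = 2" by (intro deg) blast
  qed
  have a1: "(g 0 0, g 1 0) \<in> parcs string_graph" using n1 by blast
  have row: "(g a 0, g (Suc a) 0) \<in> parcs string_graph" "g a 0 \<noteq> g (Suc (Suc a)) 0" for a
    by (rule arcR) (simp_all add: g_eq)
  have "level (g (Suc a) 0) = Suc (level (g a 0))" for a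
  proof (induction a)
    case 0
    \<comment> \<open>No vertex has size 0, so from size 1 the path can only go up.\<close>
    from level_arc[OF a1] gV[of 1 0] l1 show ?case
      by (auto simp: string_graph_vertex_iff)
  next
    case (Suc a)
    then show ?case by (rule level_step(1)[OF row(1) row(1) row(2)])
  qed
  note level_row = this
  have row_Res: "Res (g (Suc (Suc a)) 0) = g (Suc a) 0" for a
    by (rule level_step(2)[OF row(1) row(1) row(2) level_row, symmetric])
  have levels: "level (g a 0) = Suc a" for a
    by (induction a) (simp_all add: l1 level_row)
  \<comment> \<open>The path (4), (5), (5,1), (5,1,1), (6,1,1) has dimensions 1, 1, 5, 15, 21. It
    starts at (4) because \<open>level_step\<close> needs a preceding upward arc to show that the
    arc leaving (5) goes up.\<close>
  have choose: "odd ((3 + 0) choose 0 :: nat)" "odd ((4 + 0) choose 0 :: nat)"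
    "odd ((4 + 1) choose 1 :: nat)" "odd ((4 + 2) choose 2 :: nat)" "odd ((5 + 2) choose 2 :: nat)"
    by (simp_all add: choose_two)
  have arcs: "(g 3 0, g 4 0) \<in> parcs string_graph" "(g 4 0, g 4 1) \<in> parcs string_graph"
    "(g 4 1, g 4 2) \<in> parcs string_graph" "(g 4 2, g 5 2) \<in> parcs string_graph"
    using row(1)[of 3] arcD[of 4 0] arcD[of 4 1] arcR[of 4 2] choose by (simp_all add: numeral_2_eq_2)
  have neq: "g 3 0 \<noteq> g 4 1" "g 4 0 \<noteq> g 4 2" "g 4 1 \<noteq> g 5 2"
    using g_eq[OF choose(1,3)] g_eq[OF choose(2,4)] g_eq[OF choose(3,5)] by simp_all
  have l40: "level (g 4 0) = Suc (level (g 3 0))" by (simp only: levels)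
  note s41 = level_step[OF arcs(1,2) neq(1) l40]
  note s42 = level_step[OF arcs(2,3) neq(2) s41(1)]
  note s52 = level_step[OF arcs(3,4) neq(3) s42(1)]
  have l52: "level (g 5 2) = 8" using s41(1) s42(1) s52(1) levels[of 4] by linarith
  \<comment> \<open>The images of (8) and (6,1,1) both have size 8 and the image of (5) as their
    ancestor of size 5, so their ancestors of size 6, the images of (6) and (5,1), would
    coincide.\<close>
  have "Res (Res (g 7 0)) = Res (Res (g 5 2))"
  proof (rule Res_Res_eq_if_level_eight)
    show "g 7 0 \<in> pverts string_graph" "g 5 2 \<in> pverts string_graph"
      using gV[of 7 0] gV[OF choose(5)] by simp_all
    show "Res (Res (Res (g 7 0))) = Res (Res (Res (g 5 2)))"
      using row_Res[of 5] row_Res[of 4] row_Res[of 3]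
        s41(2)[symmetric] s42(2)[symmetric] s52(2)[symmetric] by simp
  qed (use levels l52 in simp_all)
  then have "g 5 0 = g 4 1"
    using row_Res[of 5] row_Res[of 4] s42(2)[symmetric] s52(2)[symmetric] by simp
  then show False using g_eq[OF _ choose(3), of 5 0] by simp
qed

end
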